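(* Let $n \geq 1$ and let $G$ be the hypertree $HT(n)$. Then the locating-domination number of $G$ is $$\gamma^{L}(G) = \begin{cases} \frac{1}{5}(2^{n+2}+1) & \text{if } n\equiv 0 \pmod 4,\\ \frac{1}{5}(2^{n+2}+2) & \text{if } n\equiv 1 \pmod 4,\\ \frac{1}{5}(2^{n+2}-1) & \text{if } n\equiv 2 \pmod 4,\\ \frac{1}{5}(2^{n+2}-2) & \text{if } n\equiv 3 \pmod 4.\end{cases}$$
   Context: The hypertree $HT(n)$ has vertex set $\{1,2,\dots,2^{n+1}-1\}$. Its edges are the edges of the complete binary tree of height $n$ in which vertex $x$ has children $2x$ and $2x+1$ (the root is $1$, at level $0$; vertex $v$ lies at level $i$ iff $2^i \le v \le 2^{i+1}-1$), together with horizontal edges: for each level $i\ge 1$, two vertices at level $i$ are adjacent if their labels differ by $2^{i-1}$. A locating-dominating set of $G$ is a set $S\subseteq V(G)$ such that every vertex of $V(G)\setminus S$ is adjacent to some vertex of $S$, and for every two distinct vertices $u,v\in V(G)\setminus S$, $N(u)\cap S\neq N(v)\cap S$ (where $N(x)$ is the open neighborhood). $\gamma^{L}(G)$ is the minimum cardinality of a locating-dominating set. *)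

theory Defs
  imports Complex_Main
begin

definition open_nbhd :: "'a set \<Rightarrow> 'a set set \<Rightarrow> 'a \<Rightarrow> 'a set" where
  "open_nbhd V E x = {y \<in> V. {x, y} \<in> E}"

definition locating_dominating :: "'a set \<Rightarrow> 'a set set \<Rightarrow> 'a set \<Rightarrow> bool" where
  "locating_dominating V E S \<longleftrightarrow>
     S \<subseteq> V \<and>
     (\<forall>v \<in> V - S. \<exists>s \<in> S. {v, s} \<in> E) \<and>
     (\<forall>u \<in> V - S. \<forall>v \<in> V - S. u \<noteq> v \<longrightarrow>
        open_nbhd V E u \<inter> S \<noteq> open_nbhd V E v \<inter> S)"

text \<open>
  The minimum is always attained when \<open>V\<close> is finite, since \<open>V\<close> itself is locating-dominating.
\<close>
definition locating_domination_number :: "'a set \<Rightarrow> 'a set set \<Rightarrow> nat" where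
  "locating_domination_number V E = (LEAST k. \<exists>S. locating_dominating V E S \<and> card S = k)"

definition HT_verts :: "nat \<Rightarrow> nat set" where
  "HT_verts n = {1..2 ^ (n + 1) - 1}"

definition HT_level :: "nat \<Rightarrow> nat set" where
  "HT_level i = {2 ^ i..2 ^ (i + 1) - 1}"

definition HT_tree_edges :: "nat \<Rightarrow> nat set set" where
  "HT_tree_edges n =
     {{x, y} | x y. x \<in> HT_verts n \<and> y \<in> HT_verts n \<and> (y = 2 * x \<or> y = 2 * x + 1)}"

definition HT_horizontal_edges :: "nat \<Rightarrow> nat set set" where
  "HT_horizontal_edges n =
     {{x, y} | x y i. 1 \<le> i \<and> i \<le> n \<and> x \<in> HT_level i \<and> y \<in> HT_level i \<and> y = x + 2 ^ (i - 1)}"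

definition HT_edges :: "nat \<Rightarrow> nat set set" where
  "HT_edges n = HT_tree_edges n \<union> HT_horizontal_edges n"

end

theory Submission
  imports Defs
begin

text \<open>
  Without its root, \<open>HT(n)\<close> is the prism over a binary tree: every vertex has a horizontal mate, and
  taking mates commutes with taking children.

  Lower bound. Let \<open>S\<close> be locating-dominating, let \<open>a, a'\<close> be mates on level \<open>n - 1\<close> and \<open>p, p'\<close> their
  parents. Then \<open>S\<close> has at least two of the six vertices \<open>a, a'\<close> and their children; exactly two only
  if \<open>p\<close> and \<open>p'\<close> are both in \<open>S\<close>, or one of them is and is the only neighbour in \<open>S\<close> of its child
  \<open>a\<close> or \<open>a'\<close>. The latter cannot happen at both children of the same vertex, so the subtrees of a pair
  of mates \<open>p, p'\<close> on level \<open>n - 2\<close> always contain at least six vertices of \<open>S\<close>. What is left of \<open>S\<close>,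
  with its vertices on level \<open>n - 3\<close> replaced by their parents, is locating-dominating in \<open>HT(n - 4)\<close>.

  Upper bound. A locating-dominating set of \<open>HT(n - 4)\<close> is extended by all of level \<open>n - 2\<close> and by
  half of level \<open>n\<close>, selected so that each leaf not selected has a selected mate and each vertex on
  level \<open>n - 1\<close> has exactly one selected child.

  Both bounds change by \<open>12 \<cdot> 2\<^bsup>n - 4\<^esup>\<close> from \<open>n - 4\<close> to \<open>n\<close>.
\<close>

section \<open>Location as injectivity of neighbourhood traces, and the levels of the
  hypertree\<close>

lemma locating_dominating_iff:
  "locating_dominating V E S \<longleftrightarrow> S \<subseteq> V \<and> (\<forall>v \<in> V - S. open_nbhd V E v \<inter> S \<noteq> {}) \<and>
     inj_on (\<lambda>v. open_nbhd V E v \<inter> S) (V - S)"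
proof -
  have "(\<exists>s\<in>S. {v, s} \<in> E) \<longleftrightarrow> open_nbhd V E v \<inter> S \<noteq> {}" if "S \<subseteq> V" for v
    using that by (auto simp: open_nbhd_def)
  then show ?thesis
    unfolding locating_dominating_def inj_on_def by meson
qed

lemma HT_level_iff: "v \<in> HT_level i \<longleftrightarrow> 2 ^ i \<le> v \<and> v < 2 * 2 ^ i"
  using one_le_power[of "2::nat" i] unfolding HT_level_def by (simp del: one_le_power, linarith)

lemma HT_verts_iff: "v \<in> HT_verts n \<longleftrightarrow> 1 \<le> v \<and> v < 2 * 2 ^ n"
  using one_le_power[of "2::nat" n] unfolding HT_verts_def by (simp del: one_le_power, linarith)

lemma finite_HT_level [simp]: "finite (HT_level i)"
  by (simp add: HT_level_def)

lemma finite_HT_verts [simp]: "finite (HT_verts n)"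
  by (simp add: HT_verts_def)

lemma card_HT_level: "card (HT_level i) = 2 ^ i"
  using one_le_power[of "2::nat" i] by (simp add: HT_level_def)

lemma HT_level_unique:
  assumes "v \<in> HT_level i" "v \<in> HT_level j"
  shows "i = j"
proof (rule ccontr)
  have *: False if "v \<in> HT_level i" "v \<in> HT_level j" "i < j" for i j
  proof -
    have "2 ^ Suc i \<le> (2::nat) ^ j"
      using that by (intro power_increasing) auto
    then show False
      using that by (auto simp: HT_level_iff)
  qed
  assume "i \<noteq> j"
  then show False
    using * assms by (metis nat_neq_iff)
qed

lemma HT_verts_Suc: "HT_verts (Suc n) = HT_verts n \<union> HT_level (Suc n)"
  using one_le_power[of "2::nat" n] by (auto simp: HT_verts_iff HT_level_iff)

lemma HT_verts_conv_levels: "HT_verts n = (\<Union>i\<le>n. HT_level i)"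
proof (induction n)
  case 0
  show ?case by (auto simp: HT_verts_iff HT_level_iff)
next
  case (Suc n)
  then show ?case by (auto simp: HT_verts_Suc atMost_Suc)
qed

lemma HT_level_subset_verts: "i \<le> n \<Longrightarrow> HT_level i \<subseteq> HT_verts n"
  by (auto simp: HT_verts_conv_levels)

lemma HT_level_verts_disjoint: "n < i \<Longrightarrow> v \<in> HT_level i \<Longrightarrow> v \<notin> HT_verts n"
  unfolding HT_verts_conv_levels using HT_level_unique by (metis UN_E atMost_iff leD)

lemma HT_children_level:
  assumes "v \<in> HT_level i"
  shows "2 * v \<in> HT_level (Suc i)" "Suc (2 * v) \<in> HT_level (Suc i)"
  using assms by (auto simp: HT_level_iff)

lemma HT_parent_level: "v \<in> HT_level (Suc i) \<Longrightarrow> v div 2 \<in> HT_level i"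
  by (auto simp: HT_level_iff)

section \<open>Mates and neighbourhoods\<close>

text \<open>The midpoint of level \<open>i\<close> is \<open>3 * 2 ^ (i - 1)\<close>, and mates are
  exchanged between the two halves. At \<open>i = 0\<close> truncated subtraction yields a
  meaningless value, so the facts about mates assume \<open>1 \<le> i\<close>.\<close>

definition mate :: "nat \<Rightarrow> nat \<Rightarrow> nat" where
  "mate i v = (if v < 3 * 2 ^ (i - 1) then v + 2 ^ (i - 1) else v - 2 ^ (i - 1))"

context
  fixes i v :: nat
  assumes v: "v \<in> HT_level i" and i: "1 \<le> i"
begin

lemma mate_level: "mate i v \<in> HT_level i"
  using v i by (cases i) (auto simp: HT_level_iff mate_def)

lemma mate_mate: "mate i (mate i v) = v"
  using v i by (cases i) (auto simp: HT_level_iff mate_def)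

text \<open>Doubling respects the halves of consecutive levels and doubles the offset between
  them.\<close>

lemma mate_children:
  "mate (Suc i) (2 * v) = 2 * mate i v" "mate (Suc i) (Suc (2 * v)) = Suc (2 * mate i v)"
  using v i by (cases i; auto simp: HT_level_iff mate_def)+

lemma eq_mate_iff:
  "u = mate i v \<longleftrightarrow> u \<in> HT_level i \<and> (u = v + 2 ^ (i - 1) \<or> v = u + 2 ^ (i - 1))"
  using v i by (cases i) (auto simp: HT_level_iff mate_def)

end

text \<open>Levels are disjoint, so the level quantified in \<open>HT_horizontal_edges\<close> can
  only be that of \<open>v\<close>; this reduces the horizontal edge at \<open>v\<close> to the
  mate.\<close>

lemma HT_edge_iff:
  assumes "v \<in> HT_level i" "i \<le> n" "u \<in> HT_verts n"
  shows "{v, u} \<in> HT_edges n \<longleftrightarrow>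
    u = 2 * v \<or> u = Suc (2 * v) \<or> v = 2 * u \<or> v = Suc (2 * u) \<or> 1 \<le> i \<and> u = mate i v"
proof -
  have vV: "v \<in> HT_verts n"
    using assms HT_level_subset_verts by blast
  have "{v, u} \<in> HT_tree_edges n \<longleftrightarrow> u = 2 * v \<or> u = Suc (2 * v) \<or> v = 2 * u \<or> v = Suc (2 * u)"
    using vV assms unfolding HT_tree_edges_def by (auto simp: doubleton_eq_iff)
  moreover have "{v, u} \<in> HT_horizontal_edges n \<longleftrightarrow> 1 \<le> i \<and> u = mate i v"
  proof
    assume "{v, u} \<in> HT_horizontal_edges n"
    then obtain j where j: "1 \<le> j" "v \<in> HT_level j" "u \<in> HT_level j"
      "u = v + 2 ^ (j - 1) \<or> v = u + 2 ^ (j - 1)"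
      unfolding HT_horizontal_edges_def by (auto simp: doubleton_eq_iff)
    moreover have "j = i"
      using j assms HT_level_unique by blast
    ultimately show "1 \<le> i \<and> u = mate i v"
      using eq_mate_iff by blast
  next
    assume i: "1 \<le> i \<and> u = mate i v"
    then have "u \<in> HT_level i \<and> (u = v + 2 ^ (i - 1) \<or> v = u + 2 ^ (i - 1))"
      using eq_mate_iff assms by blast
    then show "{v, u} \<in> HT_horizontal_edges n"
      using i assms unfolding HT_horizontal_edges_def by (auto simp: doubleton_eq_iff)
  qed
  ultimately show ?thesis
    by (auto simp: HT_edges_def)
qed

abbreviation HT_nbhd :: "nat \<Rightarrow> nat \<Rightarrow> nat set" where
  "HT_nbhd n \<equiv> open_nbhd (HT_verts n) (HT_edges n)"

abbreviation HT_LD :: "nat \<Rightarrow> nat set \<Rightarrow> bool" where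
  "HT_LD n \<equiv> locating_dominating (HT_verts n) (HT_edges n)"

text \<open>The root has neither parent nor mate, and children of vertices on level \<open>n\<close>
  fall outside \<open>HT_verts n\<close>; this accounts for the two conditionals.\<close>

lemma HT_nbhd_eq:
  assumes v: "v \<in> HT_level i" and i: "i \<le> n"
  shows "HT_nbhd n v = (if i = 0 then {} else {v div 2, mate i v}) \<union>
    (if i < n then {2 * v, Suc (2 * v)} else {})" (is "_ = ?R")
proof -
  have up: "v div 2 \<in> HT_verts n \<and> mate i v \<in> HT_verts n" if i0: "i \<noteq> 0"
  proof -
    obtain j where j: "i = Suc j"
      using i0 by (cases i) auto
    have "v div 2 \<in> HT_level j" "mate i v \<in> HT_level i"
      using HT_parent_level[of v j] mate_level[OF v] v j by auto
    then show ?thesis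
      using HT_level_subset_verts[of j n] HT_level_subset_verts[of i n] i j by auto
  qed
  have down: "2 * v \<in> HT_verts n \<and> Suc (2 * v) \<in> HT_verts n" if "i < n"
    using HT_children_level[OF v] HT_level_subset_verts[of "Suc i" n] that by auto
  have leaf: "i < n" if "u = 2 * v \<or> u = Suc (2 * v)" "u \<in> HT_verts n" for u
    using that HT_children_level[OF v] HT_level_verts_disjoint[of n "Suc i"] i
    by (metis less_Suc_eq_le not_le)
  have root: "i \<noteq> 0" if "v = 2 * u \<or> v = Suc (2 * u)" "u \<in> HT_verts n" for u
    using that v by (auto simp: HT_level_iff HT_verts_iff intro!: Nat.gr0I)
  have half: "v = 2 * u \<or> v = Suc (2 * u) \<longleftrightarrow> u = v div 2" for u
    by arith
  have "u \<in> HT_nbhd n v \<longleftrightarrow> u \<in> ?R" for u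
  proof -
    have "u \<in> HT_nbhd n v \<longleftrightarrow> u \<in> HT_verts n \<and>
        (u = 2 * v \<or> u = Suc (2 * v) \<or> (v = 2 * u \<or> v = Suc (2 * u)) \<or> 1 \<le> i \<and> u = mate i v)"
      using HT_edge_iff[OF v i, of u] unfolding open_nbhd_def by blast
    moreover have "u \<in> ?R \<longleftrightarrow>
        i \<noteq> 0 \<and> (u = v div 2 \<or> u = mate i v) \<or> i < n \<and> (u = 2 * v \<or> u = Suc (2 * v))"
      by simp
    moreover have "1 \<le> i \<longleftrightarrow> i \<noteq> 0"
      by auto
    ultimately show ?thesis
      using up down leaf[of u] root[of u] half[of u] by blast
  qed
  then show ?thesis by blast
qed

section \<open>Lower bound on the lowest three levels\<close>

definition cherry :: "nat set \<Rightarrow> nat \<Rightarrow> nat" where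
  "cherry S a = of_bool (a \<in> S) + of_bool (2 * a \<in> S) + of_bool (Suc (2 * a) \<in> S)"

text \<open>If \<open>a\<close> and \<open>a'\<close> are not both in \<open>S\<close>, domination
  puts a leaf of each pair of mated leaves into \<open>S\<close>; if both are, separating the
  children of \<open>a\<close> requires a leaf as well. So a total of two means one leaf from each
  pair and neither \<open>a\<close> nor \<open>a'\<close>. If the two leaves are siblings, their
  parent's mate can only be dominated by its own parent. Otherwise each of \<open>a\<close>,
  \<open>a'\<close> is separated from the unselected child of its mate only by its own
  parent.\<close>

lemma cherry_pair_ge:
  assumes LD: "HT_LD (Suc k) S" and a: "a \<in> HT_level k" and k: "1 \<le> k"
  defines "a' \<equiv> mate k a"
  defines "p \<equiv> a div 2" and "p' \<equiv> a' div 2"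
  shows "2 \<le> cherry S a + cherry S a'"
    and "cherry S a + cherry S a' = 2 \<Longrightarrow> p \<in> S \<and> p' \<in> S \<or>
      p \<in> S \<and> a \<notin> S \<and> HT_nbhd (Suc k) a \<inter> S = {p} \<or>
      p' \<in> S \<and> a' \<notin> S \<and> HT_nbhd (Suc k) a' \<inter> S = {p'}"
proof -
  let ?N = "HT_nbhd (Suc k)"
  have a': "a' \<in> HT_level k" and aa: "mate k a' = a"
    using mate_level[OF a k] mate_mate[OF a k] by (auto simp: a'_def)
  have dom: "v \<in> S" if "?N v \<inter> S = {}" "v \<in> HT_verts (Suc k)" for v
    using LD that unfolding locating_dominating_iff by blast
  have loc: "u \<in> S \<or> v \<in> S"
    if "?N u \<inter> S = ?N v \<inter> S" "u \<noteq> v" "u \<in> HT_verts (Suc k)" "v \<in> HT_verts (Suc k)" for u v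
    using LD that unfolding locating_dominating_iff inj_on_def by blast
  have nb: "?N a = {p, a', 2 * a, Suc (2 * a)}" "?N a' = {p', a, 2 * a', Suc (2 * a')}"
    using HT_nbhd_eq[OF a, of "Suc k"] HT_nbhd_eq[OF a', of "Suc k"] k aa
    by (auto simp: p_def p'_def a'_def)
  have nl: "?N (2 * a) = {a, 2 * a'}" "?N (Suc (2 * a)) = {a, Suc (2 * a')}"
    "?N (2 * a') = {a', 2 * a}" "?N (Suc (2 * a')) = {a', Suc (2 * a)}"
    using HT_nbhd_eq[OF HT_children_level(1)[OF a], of "Suc k"]
      HT_nbhd_eq[OF HT_children_level(2)[OF a], of "Suc k"]
      HT_nbhd_eq[OF HT_children_level(1)[OF a'], of "Suc k"]
      HT_nbhd_eq[OF HT_children_level(2)[OF a'], of "Suc k"]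
      mate_children[OF a k] mate_children[OF a' k] aa
    by (auto simp: a'_def[symmetric])
  have V: "a \<in> HT_verts (Suc k)" "a' \<in> HT_verts (Suc k)"
    "2 * a \<in> HT_verts (Suc k)" "Suc (2 * a) \<in> HT_verts (Suc k)"
    "2 * a' \<in> HT_verts (Suc k)" "Suc (2 * a') \<in> HT_verts (Suc k)"
    using a a' HT_children_level[OF a] HT_children_level[OF a']
      HT_level_subset_verts[of k "Suc k"] HT_level_subset_verts[of "Suc k" "Suc k"] by auto
  have ne: "a \<noteq> 2 * a'" "a \<noteq> Suc (2 * a')" "a' \<noteq> 2 * a" "a' \<noteq> Suc (2 * a)"
    using a a' by (auto simp: HT_level_iff)
  have d: "2 * a \<in> S \<or> a \<in> S \<or> 2 * a' \<in> S" "Suc (2 * a) \<in> S \<or> a \<in> S \<or> Suc (2 * a') \<in> S"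
    "2 * a' \<in> S \<or> a' \<in> S \<or> 2 * a \<in> S" "Suc (2 * a') \<in> S \<or> a' \<in> S \<or> Suc (2 * a) \<in> S"
    "a \<in> S \<or> p \<in> S \<or> a' \<in> S \<or> 2 * a \<in> S \<or> Suc (2 * a) \<in> S"
    "a' \<in> S \<or> p' \<in> S \<or> a \<in> S \<or> 2 * a' \<in> S \<or> Suc (2 * a') \<in> S"
    using dom[OF _ V(3)] dom[OF _ V(4)] dom[OF _ V(5)] dom[OF _ V(6)] dom[OF _ V(1)] dom[OF _ V(2)]
    unfolding nb nl by blast+
  \<comment> \<open>The pairs compared are the two children of \<open>a\<close>, and each of
    \<open>a\<close>, \<open>a'\<close> with either child of its mate.\<close>
  have l: "2 * a \<in> S \<or> Suc (2 * a) \<in> S \<or> 2 * a' \<in> S \<or> Suc (2 * a') \<in> S"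
    "a \<in> S \<or> 2 * a' \<in> S \<or> p \<in> S \<or> Suc (2 * a) \<in> S"
    "a \<in> S \<or> Suc (2 * a') \<in> S \<or> p \<in> S \<or> 2 * a \<in> S"
    "a' \<in> S \<or> 2 * a \<in> S \<or> p' \<in> S \<or> Suc (2 * a') \<in> S"
    "a' \<in> S \<or> Suc (2 * a) \<in> S \<or> p' \<in> S \<or> 2 * a' \<in> S"
    using loc[of "2 * a" "Suc (2 * a)"] loc[of a "2 * a'"] loc[of a "Suc (2 * a')"]
      loc[of a' "2 * a"] loc[of a' "Suc (2 * a)"] V ne
    unfolding nb nl by auto
  show "2 \<le> cherry S a + cherry S a'"
    using d l unfolding cherry_def
    by (cases "a \<in> S"; cases "a' \<in> S"; cases "2 * a \<in> S"; cases "2 * a' \<in> S";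
        cases "Suc (2 * a) \<in> S"; simp)
  assume "cherry S a + cherry S a' = 2"
  then have "p \<in> S \<and> p' \<in> S \<or>
      p \<in> S \<and> a \<notin> S \<and> a' \<notin> S \<and> 2 * a \<notin> S \<and> Suc (2 * a) \<notin> S \<or>
      p' \<in> S \<and> a' \<notin> S \<and> a \<notin> S \<and> 2 * a' \<notin> S \<and> Suc (2 * a') \<notin> S"
    using d l unfolding cherry_def
    by (cases "a \<in> S"; cases "a' \<in> S"; cases "2 * a \<in> S"; cases "2 * a' \<in> S";
        cases "Suc (2 * a) \<in> S"; simp split: if_splits)
  then show "p \<in> S \<and> p' \<in> S \<or>
      p \<in> S \<and> a \<notin> S \<and> ?N a \<inter> S = {p} \<or> p' \<in> S \<and> a' \<notin> S \<and> ?N a' \<inter> S = {p'}"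
    unfolding nb by blast
qed

definition branch :: "nat \<Rightarrow> nat set" where
  "branch p = {p, 2 * p, Suc (2 * p), 4 * p, Suc (4 * p), Suc (Suc (4 * p)), Suc (Suc (Suc (4 * p)))}"

text \<open>Positivity of \<open>p\<close> makes the seven labels in \<open>branch p\<close>
  distinct, so no vertex is counted twice.\<close>

lemma card_Int_branch:
  assumes "1 \<le> p"
  shows "card (S \<inter> branch p) = of_bool (p \<in> S) + cherry S (2 * p) + cherry S (Suc (2 * p))"
proof -
  have "card (S \<inter> branch p) = (\<Sum>v\<in>branch p. of_bool (v \<in> S))"
    by (simp add: branch_def Int_commute)
  also have "\<dots> = of_bool (p \<in> S) + cherry S (2 * p) + cherry S (Suc (2 * p))"
    using assms by (simp add: branch_def cherry_def)
  finally show ?thesis .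
qed

text \<open>Each of the two pairs of cherries contributes at least two. With both roots in
  \<open>S\<close> this gives 2 + 2 + 2. With one root in \<open>S\<close> the pairs cannot both
  contribute exactly two, since the children of that root would share the trace consisting of it
  alone; this gives 1 + 5. With neither root in \<open>S\<close> both pairs contribute at least
  three.\<close>

lemma branch_pair_ge:
  assumes LD: "HT_LD (Suc (Suc i)) S" and p: "p \<in> HT_level i" and i: "1 \<le> i"
  shows "6 \<le> card (S \<inter> branch p) + card (S \<inter> branch (mate i p))"
proof -
  let ?N = "HT_nbhd (Suc (Suc i))"
  define p' where "p' = mate i p"
  have p': "p' \<in> HT_level i"
    using mate_level[OF p i] by (simp add: p'_def)
  have m: "mate (Suc i) (2 * p) = 2 * p'" "mate (Suc i) (Suc (2 * p)) = Suc (2 * p')"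
    using mate_children[OF p i] by (auto simp: p'_def)
  note c1 = cherry_pair_ge[OF LD HT_children_level(1)[OF p], unfolded m, simplified]
  note c2 = cherry_pair_ge[OF LD HT_children_level(2)[OF p], unfolded m, simplified]
  have V: "2 * q \<in> HT_verts (Suc (Suc i))" "Suc (2 * q) \<in> HT_verts (Suc (Suc i))"
    if "q \<in> HT_level i" for q
    using HT_children_level[OF that] HT_level_subset_verts[of "Suc i" "Suc (Suc i)"] by auto
  have loc: "\<not> (2 * q \<notin> S \<and> Suc (2 * q) \<notin> S \<and> ?N (2 * q) \<inter> S = {q} \<and> ?N (Suc (2 * q)) \<inter> S = {q})"
    if "q \<in> HT_level i" for q
  proof
    assume *: "2 * q \<notin> S \<and> Suc (2 * q) \<notin> S \<and> ?N (2 * q) \<inter> S = {q} \<and> ?N (Suc (2 * q)) \<inter> S = {q}"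
    then have "2 * q = Suc (2 * q)"
      using LD V[OF that] unfolding locating_dominating_iff
      by (intro inj_onD[of "\<lambda>v. ?N v \<inter> S" "HT_verts (Suc (Suc i)) - S"]) auto
    then show False by simp
  qed
  let ?x = "cherry S (2 * p) + cherry S (2 * p')"
  let ?y = "cherry S (Suc (2 * p)) + cherry S (Suc (2 * p'))"
  have "p \<in> S \<and> p' \<in> S \<or> ?x \<noteq> 2 \<or> ?y \<noteq> 2" "p \<in> S \<or> p' \<in> S \<or> ?x \<noteq> 2 \<and> ?y \<noteq> 2"
    using c1(2) c2(2) loc[OF p] loc[OF p'] by blast+
  then have "6 \<le> of_bool (p \<in> S) + cherry S (2 * p) + cherry S (Suc (2 * p)) +
      (of_bool (p' \<in> S) + cherry S (2 * p') + cherry S (Suc (2 * p')))"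
    using c1(1) c2(1) by (cases "p \<in> S"; cases "p' \<in> S"; simp; linarith)
  moreover have "1 \<le> p" "1 \<le> p'"
    using p p' one_le_power[of "2::nat" i] unfolding HT_level_iff by linarith+
  ultimately show ?thesis
    by (simp add: card_Int_branch p'_def[symmetric])
qed

lemma branch_disjoint:
  assumes "p \<in> HT_level i" "q \<in> HT_level i" "p \<noteq> q"
  shows "branch p \<inter> branch q = {}"
proof -
  \<comment> \<open>The level of \<open>v\<close> tells how often to halve it to get back to the
    root of its branch.\<close>
  have root: "p = (if v < 2 * 2 ^ i then v else if v < 4 * 2 ^ i then v div 2 else v div 4)"
    if "v \<in> branch p" "p \<in> HT_level i" for v p
  proof -
    have "Suc (4 * p) div 4 = p" "Suc (Suc (4 * p)) div 4 = p" "Suc (Suc (Suc (4 * p))) div 4 = p"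
      by simp_all
    then show ?thesis
      using that by (auto simp: branch_def HT_level_iff)
  qed
  show ?thesis
    using root[of _ p] root[of _ q] assms by blast
qed

lemma branch_subset:
  assumes "p \<in> HT_level i"
  shows "branch p \<subseteq> HT_level i \<union> HT_level (Suc i) \<union> HT_level (Suc (Suc i))"
  using assms by (auto simp: branch_def HT_level_iff)

text \<open>As \<open>mate i\<close> permutes the level, summing the pair bound over the whole level
  counts every branch twice, which leaves an average of three per branch.\<close>

lemma card_Int_branches_ge:
  assumes LD: "HT_LD (Suc (Suc i)) S" and i: "1 \<le> i"
  shows "3 * 2 ^ i \<le> card (S \<inter> (\<Union>p\<in>HT_level i. branch p))"
proof -
  let ?f = "\<lambda>p. card (S \<inter> branch p)"
  have "bij_betw (mate i) (HT_level i) (HT_level i)"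
    by (rule bij_betw_byWitness[where f' = "mate i"]) (auto intro: mate_level mate_mate i)
  then have "(\<Sum>p\<in>HT_level i. ?f (mate i p)) = (\<Sum>p\<in>HT_level i. ?f p)"
    by (rule sum.reindex_bij_betw)
  then have "2 * (\<Sum>p\<in>HT_level i. ?f p) = (\<Sum>p\<in>HT_level i. ?f p + ?f (mate i p))"
    by (simp add: sum.distrib)
  moreover have "\<dots> \<ge> (\<Sum>p\<in>HT_level i. 6)"
    using branch_pair_ge[OF LD _ i] by (intro sum_mono) auto
  ultimately have "3 * 2 ^ i \<le> (\<Sum>p\<in>HT_level i. ?f p)"
    by (simp add: card_HT_level)
  also have "\<dots> = card (\<Union>p\<in>HT_level i. S \<inter> branch p)"
    using branch_disjoint by (intro card_UN_disjoint[symmetric]) (auto simp: branch_def)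
  also have "(\<Union>p\<in>HT_level i. S \<inter> branch p) = S \<inter> (\<Union>p\<in>HT_level i. branch p)"
    by blast
  finally show ?thesis .
qed

section \<open>Removing four levels\<close>

lemma finite_HT_LD: "HT_LD n S \<Longrightarrow> finite S"
  unfolding locating_dominating_def by (meson finite_HT_verts finite_subset)

text \<open>Moving elements on level \<open>Suc m\<close> to their parents absorbs every vertex on
  level \<open>m\<close> that has a child in \<open>S\<close>. The vertices left outside the new set
  therefore lose no neighbour in \<open>S\<close>.\<close>

lemma HT_LD_reduce:
  assumes LD: "HT_LD (m + 4) S"
  obtains S' where "HT_LD m S'" "card S' + 12 * 2 ^ m \<le> card S"
proof
  let ?n = "m + 4"
  let ?S' = "S \<inter> HT_verts m \<union> (\<lambda>v. v div 2) ` (S \<inter> HT_level (Suc m))"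
  let ?B = "\<Union>p\<in>HT_level (m + 2). branch p"
  \<comment> \<open>The old trace is the new one cut down to \<open>S\<close>, hence a function of
    it: nonemptiness and injectivity carry over.\<close>
  have nb: "HT_nbhd ?n v \<inter> S = HT_nbhd m v \<inter> ?S' \<inter> S" if v: "v \<in> HT_verts m - ?S'" for v
  proof -
    obtain i where i: "v \<in> HT_level i" "i \<le> m"
      using v by (auto simp: HT_verts_conv_levels)
    have *: "w \<notin> S" if "i = m" "w = 2 * v \<or> w = Suc (2 * v)" for w
    proof
      assume "w \<in> S"
      then have "w \<in> S \<inter> HT_level (Suc m)"
        using HT_children_level[OF i(1)] that by auto
      then have "w div 2 \<in> ?S'"
        by blast
      moreover have "w div 2 = v"
        using that by auto
      ultimately show False
        using v by auto
    qed
    have "HT_nbhd ?n v \<inter> S = HT_nbhd m v \<inter> S"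
      using * HT_nbhd_eq[OF i(1), of ?n] HT_nbhd_eq[OF i(1,2)] i(2)
      by (cases "i = m") auto
    also have "\<dots> = HT_nbhd m v \<inter> ?S' \<inter> S"
      by (auto simp: open_nbhd_def)
    finally show ?thesis .
  qed
  have sub: "HT_verts m - ?S' \<subseteq> HT_verts ?n - S"
    by (auto simp: HT_verts_conv_levels)
  have "?S' \<subseteq> HT_verts m"
    using HT_parent_level HT_level_subset_verts[of m m] by auto
  moreover have "HT_nbhd m v \<inter> ?S' \<noteq> {}" if v: "v \<in> HT_verts m - ?S'" for v
  proof -
    have "HT_nbhd ?n v \<inter> S \<noteq> {}"
      using LD sub v unfolding locating_dominating_iff by blast
    then show ?thesis
      unfolding nb[OF v] by blast
  qed
  moreover have "inj_on (\<lambda>v. HT_nbhd m v \<inter> ?S') (HT_verts m - ?S')"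
  proof (rule inj_onI)
    fix u v
    assume u: "u \<in> HT_verts m - ?S'" and v: "v \<in> HT_verts m - ?S'"
      and "HT_nbhd m u \<inter> ?S' = HT_nbhd m v \<inter> ?S'"
    then have "HT_nbhd ?n u \<inter> S = HT_nbhd ?n v \<inter> S"
      unfolding nb[OF u] nb[OF v] by simp
    then show "u = v"
      using LD u v sub unfolding locating_dominating_iff inj_on_def by blast
  qed
  ultimately show "HT_LD m ?S'"
    unfolding locating_dominating_iff by blast
  have fin: "finite S"
    using LD by (rule finite_HT_LD)
  have "card ?S' \<le> card (S \<inter> HT_verts m) + card ((\<lambda>v. v div 2) ` (S \<inter> HT_level (Suc m)))"
    by (rule card_Un_le)
  also have "\<dots> \<le> card (S \<inter> HT_verts m) + card (S \<inter> HT_level (Suc m))"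
    using fin by (simp add: card_image_le)
  also have "\<dots> = card (S \<inter> HT_verts m \<union> S \<inter> HT_level (Suc m))"
    using fin HT_level_verts_disjoint[of m "Suc m"] by (intro card_Un_disjoint[symmetric]) auto
  also have "\<dots> = card (S \<inter> HT_verts (Suc m))"
    by (simp add: HT_verts_Suc Int_Un_distrib)
  finally have 1: "card ?S' \<le> card (S \<inter> HT_verts (Suc m))" .
  \<comment> \<open>This is \<open>3 * 2 ^ (m + 2)\<close>, from the branches rooted on level
    \<open>m + 2\<close>, which occupy levels \<open>m + 2\<close> to \<open>m + 4\<close>.\<close>
  have "12 * 2 ^ m \<le> card (S \<inter> ?B)"
    using card_Int_branches_ge[of "m + 2" S] LD by (simp add: numeral_eq_Suc)
  then have "card ?S' + 12 * 2 ^ m \<le> card (S \<inter> HT_verts (Suc m)) + card (S \<inter> ?B)"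
    using 1 by simp
  also have "\<dots> = card (S \<inter> HT_verts (Suc m) \<union> S \<inter> ?B)"
  proof (rule card_Un_disjoint[symmetric])
    have "v \<notin> HT_verts (Suc m)" if "v \<in> ?B" for v
      using that branch_subset HT_level_verts_disjoint[of "Suc m" "m + 2" v]
        HT_level_verts_disjoint[of "Suc m" "Suc (m + 2)" v]
        HT_level_verts_disjoint[of "Suc m" "Suc (Suc (m + 2))" v] by fastforce
    then show "S \<inter> HT_verts (Suc m) \<inter> (S \<inter> ?B) = {}"
      by blast
  qed (use fin in auto)
  also have "\<dots> \<le> card S"
    using fin by (intro card_mono) auto
  finally show "card ?S' + 12 * 2 ^ m \<le> card S" .
qed

section \<open>Adding four levels\<close>

lemma HT_LD_extend:
  assumes LD: "HT_LD m S"
  obtains S' where "HT_LD (m + 4) S'" "card S' \<le> card S + 12 * 2 ^ m"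
proof
  let ?n = "m + 4"
  \<comment> \<open>The midpoint of level \<open>m + 3\<close>. Vertices below it pick their left
    child, the others their right child; mates lie in opposite halves and so pick on opposite
    sides.\<close>
  define t :: nat where "t = 3 * 2 ^ (m + 2)"
  define pick where "pick a = (if a < t then 2 * a else Suc (2 * a))" for a
  let ?L1 = "HT_level (m + 1)" and ?L2 = "HT_level (m + 2)"
    and ?L3 = "HT_level (m + 3)" and ?L4 = "HT_level (m + 4)"
  let ?S' = "S \<union> ?L2 \<union> pick ` ?L3"
  let ?X = "\<lambda>v. HT_nbhd ?n v \<inter> ?S'"
  have SV: "S \<subseteq> HT_verts m"
    using LD unfolding locating_dominating_iff by blast
  have V: "HT_verts ?n = HT_verts m \<union> ?L1 \<union> ?L2 \<union> ?L3 \<union> ?L4"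
    using HT_verts_Suc[of m] HT_verts_Suc[of "m + 1"] HT_verts_Suc[of "m + 2"]
      HT_verts_Suc[of "m + 3"] by (simp add: numeral_eq_Suc)
  have pick4: "pick ` ?L3 \<subseteq> ?L4"
    using HT_children_level[of _ "m + 3"] by (auto simp: pick_def numeral_eq_Suc)
  have disj: "v \<notin> HT_level j" if "v \<in> HT_level i" "i \<noteq> j" for i j v
    using that HT_level_unique by blast
  have disjV: "v \<notin> HT_verts m" if "v \<in> HT_level i" "m < i" for i v
    using that HT_level_verts_disjoint by blast
  have mem0: "v \<in> ?S' \<longleftrightarrow> v \<in> S" if "v \<in> HT_verts m" for v
    using that pick4 disjV[of v "m + 2"] disjV[of v "m + 4"] by auto
  have mem1: "v \<notin> ?S'" if "v \<in> ?L1" for v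
    using that SV pick4 disjV[of v "m + 1"] disj[of v "m + 1" "m + 2"] disj[of v "m + 1" "m + 4"]
    by auto
  have mem3: "v \<notin> ?S'" if "v \<in> ?L3" for v
    using that SV pick4 disjV[of v "m + 3"] disj[of v "m + 3" "m + 2"] disj[of v "m + 3" "m + 4"]
    by auto
  have mem4: "v \<in> ?S' \<longleftrightarrow> v \<in> pick ` ?L3" if "v \<in> ?L4" for v
    using that SV disjV[of v "m + 4"] disj[of v "m + 4" "m + 2"] by auto
  have pick_iff: "2 * a \<in> pick ` ?L3 \<longleftrightarrow> a < t" "Suc (2 * a) \<in> pick ` ?L3 \<longleftrightarrow> \<not> a < t"
    if "a \<in> ?L3" for a
  proof -
    have "2 * a = pick b \<longleftrightarrow> b = a \<and> a < t" "Suc (2 * a) = pick b \<longleftrightarrow> b = a \<and> \<not> a < t" for b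
      unfolding pick_def by (auto split: if_splits) presburger+
    then show "2 * a \<in> pick ` ?L3 \<longleftrightarrow> a < t" "Suc (2 * a) \<in> pick ` ?L3 \<longleftrightarrow> \<not> a < t"
      using that by (auto simp: image_iff)
  qed
  have ch: "2 * a \<in> ?L4" "Suc (2 * a) \<in> ?L4" if "a \<in> ?L3" for a
    using HT_children_level[of a "m + 3"] that by (simp_all add: numeral_eq_Suc)
  have mate3: "mate (m + 3) a < t \<longleftrightarrow> \<not> a < t" if "a \<in> ?L3" for a
    using that by (auto simp: HT_level_iff mate_def t_def numeral_eq_Suc)
  \<comment> \<open>The parent's mate picks on the side of \<open>v\<close>, so the mate of an
    unselected leaf is selected, while its parent on level \<open>m + 3\<close> is not.\<close>
  have X4: "?X v = {mate (m + 4) v}" if v: "v \<in> ?L4 - ?S'" for v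
  proof -
    define a where "a = v div 2"
    have a: "a \<in> ?L3"
      using v HT_parent_level[of v "m + 3"] by (simp add: a_def numeral_eq_Suc)
    have a': "mate (m + 3) a \<in> ?L3"
      using mate_level[OF a] by simp
    have mc: "mate (m + 4) (2 * a) = 2 * mate (m + 3) a"
      "mate (m + 4) (Suc (2 * a)) = Suc (2 * mate (m + 3) a)"
      using mate_children[OF a] by (simp_all add: numeral_eq_Suc)
    have "v = 2 * a \<or> v = Suc (2 * a)"
      unfolding a_def by presburger
    then have "mate (m + 4) v \<in> pick ` ?L3"
      using v mem4[of v] pick_iff[OF a] pick_iff[OF a'] mate3[OF a] mc by auto
    moreover have "HT_nbhd ?n v = {a, mate (m + 4) v}"
      using HT_nbhd_eq[of v "m + 4" ?n] v by (auto simp: a_def)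
    ultimately show ?thesis
      using mem3[OF a] by auto
  qed
  have X3: "?X v = {v div 2, pick v}" if v: "v \<in> ?L3" for v
  proof -
    have "HT_nbhd ?n v = {v div 2, mate (m + 3) v, 2 * v, Suc (2 * v)}"
      using HT_nbhd_eq[OF v, of ?n] by auto
    moreover have "v div 2 \<in> ?S'"
      using v HT_parent_level[of v "m + 2"] by (simp add: numeral_eq_Suc)
    moreover have "mate (m + 3) v \<notin> ?S'"
      using mate_level[OF v] mem3 by simp
    moreover have "2 * v \<in> ?S' \<longleftrightarrow> v < t" "Suc (2 * v) \<in> ?S' \<longleftrightarrow> \<not> v < t"
      using mem4 ch[OF v] pick_iff[OF v] by blast+
    ultimately show ?thesis
      by (auto simp: pick_def)
  qed
  \<comment> \<open>Only the part of the trace on levels \<open>m + 2\<close> and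
    \<open>m + 4\<close> is fixed: the parent of \<open>v\<close>, on level \<open>m\<close>, may or
    may not be in \<open>S\<close>.\<close>
  have X1: "?X v \<inter> ?L2 = {2 * v, Suc (2 * v)}" "?X v \<inter> ?L4 = {}" if v: "v \<in> ?L1" for v
  proof -
    have nb: "HT_nbhd ?n v = {v div 2, mate (m + 1) v, 2 * v, Suc (2 * v)}"
      using HT_nbhd_eq[OF v, of ?n] by auto
    have lv: "v div 2 \<in> HT_level m" "mate (m + 1) v \<in> ?L1" "2 * v \<in> ?L2" "Suc (2 * v) \<in> ?L2"
      using v HT_parent_level[of v m] mate_level[OF v] HT_children_level[OF v]
      by (simp_all add: numeral_eq_Suc)
    show "?X v \<inter> ?L2 = {2 * v, Suc (2 * v)}" "?X v \<inter> ?L4 = {}"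
      using lv disj[OF lv(1)] disj[OF lv(2)] disj[OF lv(3)] disj[OF lv(4)]
      unfolding nb by auto
  qed
  \<comment> \<open>Level \<open>m + 1\<close> contains no selected vertex, so the vertices of the
    smaller hypertree see nothing new.\<close>
  have X0: "?X v = HT_nbhd m v \<inter> S" if v: "v \<in> HT_verts m" for v
  proof -
    obtain i where i: "v \<in> HT_level i" "i \<le> m"
      using v by (auto simp: HT_verts_conv_levels)
    have "2 * v \<notin> ?S'" "Suc (2 * v) \<notin> ?S'" if "i = m"
      using mem1 HT_children_level[OF i(1)] that by simp_all
    then have "?X v = HT_nbhd m v \<inter> ?S'"
      using HT_nbhd_eq[OF i(1), of ?n] HT_nbhd_eq[OF i(1,2)] i(2) by (cases "i = m") auto
    also have "\<dots> = HT_nbhd m v \<inter> S"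
      using mem0 by (auto simp: open_nbhd_def)
    finally show ?thesis .
  qed
  have X0': "?X v \<inter> ?L2 = {} \<and> ?X v \<inter> ?L4 = {}" if v: "v \<in> HT_verts m" for v
    unfolding X0[OF v] using SV disjV[of _ "m + 2"] disjV[of _ "m + 4"] by auto
  have X3': "?X v \<inter> ?L2 = {v div 2} \<and> ?X v \<inter> ?L4 = {pick v}" if v: "v \<in> ?L3" for v
  proof -
    have "v div 2 \<in> ?L2" "pick v \<in> ?L4"
      using v HT_parent_level[of v "m + 2"] pick4 by (auto simp: numeral_eq_Suc)
    then show ?thesis
      unfolding X3[OF v] using disj[of _ "m + 2" "m + 4"] disj[of _ "m + 4" "m + 2"] by auto
  qed
  have X4': "?X v \<inter> ?L2 = {} \<and> ?X v \<inter> ?L4 = {mate (m + 4) v}" if v: "v \<in> ?L4 - ?S'" for v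
    unfolding X4[OF v] using mate_level[of v "m + 4"] v disj[of _ "m + 4" "m + 2"] by auto
  have cases: "v \<in> HT_verts m - S \<or> v \<in> ?L1 \<or> v \<in> ?L3 \<or> v \<in> ?L4 - ?S'"
    if "v \<in> HT_verts ?n - ?S'" for v
    using that unfolding V by blast
  have "?S' \<subseteq> HT_verts ?n"
    using SV pick4 unfolding V by blast
  moreover have "?X v \<noteq> {}" if "v \<in> HT_verts ?n - ?S'" for v
    using cases[OF that]
  proof (elim disjE)
    assume "v \<in> HT_verts m - S"
    then show ?thesis
      using LD X0[of v] unfolding locating_dominating_iff by auto
  next
    assume "v \<in> ?L1"
    then show ?thesis
      using X1 by blast
  qed (use X3 X4 in auto)
  moreover have "inj_on ?X (HT_verts ?n - ?S')"
  proof (rule inj_onI)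
    fix u v
    assume u: "u \<in> HT_verts ?n - ?S'" and v: "v \<in> HT_verts ?n - ?S'" and eq: "?X u = ?X v"
    \<comment> \<open>Whether a trace meets \<open>?L2\<close> and whether it meets
      \<open>?L4\<close> identifies the class of its vertex: neither for \<open>HT_verts m\<close>,
      only \<open>?L2\<close> for \<open>?L1\<close>, both for \<open>?L3\<close>, only
      \<open>?L4\<close> for \<open>?L4\<close>. Within a class the trace then determines the
      vertex.\<close>
    have eq2: "?X u \<inter> ?L2 = ?X v \<inter> ?L2" and eq4: "?X u \<inter> ?L4 = ?X v \<inter> ?L4"
      using eq by simp_all
    show "u = v"
      using cases[OF u]
    proof (elim disjE)
      assume u0: "u \<in> HT_verts m - S"
      then have "v \<in> HT_verts m - S"
        using cases[OF v] eq2 eq4 X0'[of u] X1[of v] X3'[of v] X4'[of v] by auto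
      then show "u = v"
        using u0 eq X0[of u] X0[of v] LD unfolding locating_dominating_iff inj_on_def by auto
    next
      assume u1: "u \<in> ?L1"
      then have "v \<in> ?L1"
        using cases[OF v] eq2 eq4 X1[of u] X0'[of v] X3'[of v] X4'[of v] by auto
      then have "{2 * u, Suc (2 * u)} = {2 * v, Suc (2 * v)}"
        using X1(1) u1 eq2 by simp
      then show "u = v"
        unfolding doubleton_eq_iff by presburger
    next
      assume u3: "u \<in> ?L3"
      then have "v \<in> ?L3"
        using cases[OF v] eq2 eq4 X3'[of u] X0'[of v] X1[of v] X4'[of v] by auto
      then have "pick u = pick v"
        using X3' u3 eq4 by simp
      then show "u = v"
        unfolding pick_def by (simp split: if_splits)
    next
      assume u4: "u \<in> ?L4 - ?S'"
      then have v4: "v \<in> ?L4 - ?S'"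
        using cases[OF v] eq2 eq4 X4'[of u] X0'[of v] X1[of v] X3'[of v] by auto
      then have "mate (m + 4) u = mate (m + 4) v"
        using eq unfolding X4[OF u4] X4[OF v4] by simp
      moreover have "mate (m + 4) (mate (m + 4) u) = u" "mate (m + 4) (mate (m + 4) v) = v"
        using u4 v4 by (auto intro!: mate_mate)
      ultimately show "u = v"
        by metis
    qed
  qed
  ultimately show "HT_LD ?n ?S'"
    unfolding locating_dominating_iff by blast
  have "card ?S' \<le> card S + card ?L2 + card (pick ` ?L3)"
    by (meson add_le_mono1 card_Un_le le_trans)
  also have "\<dots> \<le> card S + card ?L2 + card ?L3"
    by (simp add: card_image_le)
  also have "\<dots> = card S + 12 * 2 ^ m"
    by (simp add: card_HT_level power_add)
  finally show "card ?S' \<le> card S + 12 * 2 ^ m" .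
qed

section \<open>Heights zero to three\<close>

lemma HT_verts_small:
  "HT_verts 0 = {1}" "HT_verts 1 = {1, 2, 3}" "HT_verts 2 = branch 1"
  by (auto simp: HT_verts_iff branch_def)

lemma HT_nbhd_1: "HT_nbhd 1 1 = {2, 3}" "HT_nbhd 1 2 = {1, 3}" "HT_nbhd 1 3 = {1, 2}"
  using HT_nbhd_eq[of 1 0 1] HT_nbhd_eq[of 2 1 1] HT_nbhd_eq[of 3 1 1]
  by (simp_all add: HT_level_iff mate_def)

lemma HT_LD_0_ge: "HT_LD 0 S \<Longrightarrow> 1 \<le> card S"
  using HT_nbhd_eq[of 1 0 0] finite_HT_LD[of 0 S]
  by (auto simp: locating_dominating_iff HT_verts_small HT_level_iff Suc_le_eq card_gt_0_iff)

text \<open>\<open>HT(1)\<close> is a triangle, so two vertices outside \<open>S\<close> would have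
  the same trace.\<close>

lemma HT_LD_1_ge:
  assumes LD: "HT_LD 1 S"
  shows "2 \<le> card S"
proof -
  have sub: "S \<subseteq> {1, 2, 3}"
    using LD unfolding locating_dominating_iff HT_verts_small by blast
  have loc: "u \<in> S \<or> v \<in> S"
    if "HT_nbhd 1 u \<inter> S = HT_nbhd 1 v \<inter> S" "u \<noteq> v" "u \<in> {1, 2, 3}" "v \<in> {1, 2, 3}" for u v
    using LD that unfolding locating_dominating_iff HT_verts_small inj_on_def by blast
  have "1 \<in> S \<or> 2 \<in> S" "1 \<in> S \<or> 3 \<in> S" "2 \<in> S \<or> 3 \<in> S"
    using loc[of 1 2] loc[of 1 3] loc[of 2 3] unfolding HT_nbhd_1 by auto
  then have "{1, 2} \<subseteq> S \<or> {1, 3} \<subseteq> S \<or> {2, 3} \<subseteq> S"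
    by blast
  then show ?thesis
    using card_mono[OF finite_HT_LD[OF LD], of "{1, 2}"] card_mono[OF finite_HT_LD[OF LD], of "{1, 3}"]
      card_mono[OF finite_HT_LD[OF LD], of "{2, 3}"] by auto
qed

lemma HT_LD_2_ge:
  assumes LD: "HT_LD 2 S"
  shows "3 \<le> card S"
proof -
  have LD': "HT_LD (Suc 1) S" and a: "2 \<in> HT_level 1"
    using LD by (simp_all add: numeral_eq_Suc HT_level_iff)
  have "mate 1 2 = 3"
    by (simp add: mate_def)
  \<comment> \<open>Here both parents in the equality case are the root, so a total of two forces
    the root into \<open>S\<close>.\<close>
  then have "2 \<le> cherry S 2 + cherry S 3" "cherry S 2 + cherry S 3 \<noteq> 2 \<or> 1 \<in> S"
    using cherry_pair_ge[OF LD' a] by auto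
  moreover have "card (S \<inter> branch 1) = of_bool (1 \<in> S) + cherry S 2 + cherry S 3"
    using card_Int_branch[of 1 S] by simp
  ultimately have "3 \<le> card (S \<inter> branch 1)"
    by (cases "1 \<in> S") simp_all
  also have "S \<inter> branch 1 = S"
    using LD by (auto simp: locating_dominating_iff HT_verts_small)
  finally show ?thesis .
qed

text \<open>The branches rooted at the mates 2 and 3 already contain six elements.\<close>

lemma HT_LD_3_ge:
  assumes LD: "HT_LD 3 S"
  shows "6 \<le> card S"
proof -
  have "6 \<le> card (S \<inter> (\<Union>p\<in>HT_level 1. branch p))"
    using card_Int_branches_ge[of 1 S] LD by (simp add: numeral_eq_Suc)
  also have "\<dots> \<le> card S"
    using finite_HT_LD[OF LD] by (intro card_mono) auto
  finally show ?thesis .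
qed

lemma HT_LD_0: "HT_LD 0 {1}"
  by (simp add: locating_dominating_iff HT_verts_small)

lemma HT_LD_1: "HT_LD 1 {2, 3}"
proof -
  have "HT_verts 1 - {2, 3} = {1}"
    unfolding HT_verts_small by auto
  then show ?thesis
    unfolding locating_dominating_iff HT_nbhd_1 by (simp add: HT_nbhd_1[simplified] HT_verts_iff)
qed

text \<open>The witness follows the pattern of the extension step: all of level 0, the left child of
  2 and the right child of 3.\<close>

lemma HT_LD_2: "HT_LD 2 {1, 4, 7}"
proof -
  have "HT_nbhd 2 2 = {1, 3, 4, 5}" "HT_nbhd 2 3 = {1, 2, 6, 7}"
    "HT_nbhd 2 5 = {2, 7}" "HT_nbhd 2 6 = {3, 4}"
    using HT_nbhd_eq[of 2 1 2] HT_nbhd_eq[of 3 1 2] HT_nbhd_eq[of 5 2 2] HT_nbhd_eq[of 6 2 2]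
    by (auto simp: HT_level_iff mate_def)
  moreover have "HT_verts 2 - {1, 4, 7} = {2, 3, 5, 6}" "{1, 4, 7} \<subseteq> HT_verts 2"
    by (auto simp: HT_verts_iff)
  ultimately show ?thesis
    by (simp add: locating_dominating_iff doubleton_eq_iff)
qed

text \<open>The same pattern again: all of level 1, the left children of 4 and 5, and the right
  children of 6 and 7.\<close>

lemma HT_LD_3: "HT_LD 3 {2, 3, 8, 10, 13, 15}"
proof -
  have "HT_nbhd 3 1 = {2, 3}"
    "HT_nbhd 3 4 = {2, 6, 8, 9}" "HT_nbhd 3 5 = {2, 7, 10, 11}"
    "HT_nbhd 3 6 = {3, 4, 12, 13}" "HT_nbhd 3 7 = {3, 5, 14, 15}"
    "HT_nbhd 3 9 = {4, 13}" "HT_nbhd 3 11 = {5, 15}" "HT_nbhd 3 12 = {6, 8}" "HT_nbhd 3 14 = {7, 10}"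
    using HT_nbhd_eq[of 1 0 3] HT_nbhd_eq[of 4 2 3] HT_nbhd_eq[of 5 2 3] HT_nbhd_eq[of 6 2 3]
      HT_nbhd_eq[of 7 2 3] HT_nbhd_eq[of 9 3 3] HT_nbhd_eq[of 11 3 3] HT_nbhd_eq[of 12 3 3]
      HT_nbhd_eq[of 14 3 3]
    by (auto simp: HT_level_iff mate_def)
  moreover have "HT_verts 3 - {2, 3, 8, 10, 13, 15} = {1, 4, 5, 6, 7, 9, 11, 12, 14}"
    "{2, 3, 8, 10, 13, 15} \<subseteq> HT_verts 3"
    by (auto simp: HT_verts_iff) presburger
  ultimately show ?thesis
    by (simp add: locating_dominating_iff doubleton_eq_iff)
qed

section \<open>Recursion with step four, and its closed form\<close>

fun HT_LD_num :: "nat \<Rightarrow> nat" where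
  "HT_LD_num 0 = 1"
| "HT_LD_num (Suc 0) = 2"
| "HT_LD_num (Suc (Suc 0)) = 3"
| "HT_LD_num (Suc (Suc (Suc 0))) = 6"
| "HT_LD_num (Suc (Suc (Suc (Suc m)))) = HT_LD_num m + 12 * 2 ^ m"

lemma HT_LD_num_le: "HT_LD n S \<Longrightarrow> HT_LD_num n \<le> card S"
proof (induction n arbitrary: S rule: HT_LD_num.induct)
  case (5 m)
  then have "HT_LD (m + 4) S"
    by (simp add: numeral_eq_Suc)
  then obtain S' where "HT_LD m S'" "card S' + 12 * 2 ^ m \<le> card S"
    by (rule HT_LD_reduce)
  with "5.IH"[of S'] show ?case
    by simp
qed (use HT_LD_0_ge HT_LD_1_ge HT_LD_2_ge HT_LD_3_ge in \<open>simp_all add: numeral_eq_Suc\<close>)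

lemma HT_LD_num_attained: "\<exists>S. HT_LD n S \<and> card S \<le> HT_LD_num n"
proof (induction n rule: HT_LD_num.induct)
  case 1
  show ?case using HT_LD_0 by (intro exI[of _ "{1}"]) simp
next
  case 2
  show ?case using HT_LD_1 by (intro exI[of _ "{2, 3}"]) simp
next
  case 3
  show ?case using HT_LD_2 by (intro exI[of _ "{1, 4, 7}"]) (simp add: numeral_2_eq_2)
next
  case 4
  show ?case using HT_LD_3
    by (intro exI[of _ "{2, 3, 8, 10, 13, 15}"]) (simp add: numeral_3_eq_3)
next
  case (5 m)
  then obtain S where S: "HT_LD m S" "card S \<le> HT_LD_num m"
    by blast
  obtain S' where "HT_LD (m + 4) S'" "card S' \<le> card S + 12 * 2 ^ m"
    using HT_LD_extend[OF S(1)] .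
  with S(2) show ?case
    by (intro exI[of _ S']) (simp add: numeral_eq_Suc)
qed

lemma locating_domination_number_HT:
  "locating_domination_number (HT_verts n) (HT_edges n) = HT_LD_num n"
  unfolding locating_domination_number_def
proof (rule Least_equality)
  show "\<exists>S. HT_LD n S \<and> card S = HT_LD_num n"
    using HT_LD_num_attained HT_LD_num_le by (metis order_antisym)
qed (use HT_LD_num_le in blast)

text \<open>The induction step rests on \<open>2 ^ (m + 6) - 2 ^ (m + 2) = 5 * (12 * 2 ^ m)\<close>:
  the correction added to the power of two depends only on \<open>n mod 4\<close>.\<close>

lemma HT_LD_num_closed_form:
  "real (HT_LD_num n) =
    (if n mod 4 = 0 then (1 / 5) * (2 ^ (n + 2) + 1)
     else if n mod 4 = 1 then (1 / 5) * (2 ^ (n + 2) + 2)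
     else if n mod 4 = 2 then (1 / 5) * (2 ^ (n + 2) - 1)
     else (1 / 5) * (2 ^ (n + 2) - 2))"
proof (induction n rule: HT_LD_num.induct)
  case (5 m)
  have "Suc (Suc (Suc (Suc m))) mod 4 = m mod 4"
    by presburger
  with 5 show ?case
    by (auto split: if_splits simp: field_simps)
qed simp_all

theorem theorem3:
  fixes n :: nat
  assumes "n \<ge> 1"
  shows "real (locating_domination_number (HT_verts n) (HT_edges n)) =
    (if n mod 4 = 0 then (1 / 5) * (2 ^ (n + 2) + 1)
     else if n mod 4 = 1 then (1 / 5) * (2 ^ (n + 2) + 2)
     else if n mod 4 = 2 then (1 / 5) * (2 ^ (n + 2) - 1)
     else (1 / 5) * (2 ^ (n + 2) - 2))"
  unfolding locating_domination_number_HT by (rule HT_LD_num_closed_form)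

end
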